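(* Let $P$ be a convex polytope. Then there is a coefficient-wise inequality of polynomials in $t$ $$F_P(1,t)\leqslant F_P(-1,t+1),$$ (i.e. for every $k\geqslant 0$ the coefficient of $t^k$ in $F_P(1,t)$ is at most the coefficient of $t^k$ in $F_P(-1,t+1)$), and this inequality is an equality for the terms $t^0$ and $t^1$.
   Context: For a face $F$ of a convex polytope $P$, $m(F)$ is the number of facets of $P$ containing $F$. The two-dimensional face polynomial of $P$ is $$F_P(\alpha,t)=\sum_{F\subseteq P}\alpha^{\dim F}t^{m(F)},$$ the sum being over all nonempty faces of $P$, including $P$ itself. *)

theory Defs
  imports "HOL-Analysis.Analysis" "HOL-Computational_Algebra.Polynomial"
begin

definition num_facets_containing :: "'a::euclidean_space set \<Rightarrow> 'a set \<Rightarrow> nat" where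
  "num_facets_containing P F = card {G. G facet_of P \<and> F \<subseteq> G}"

text \<open>
  The face polynomial lives in \<open>\<int>[t][\<alpha>]\<close>: the outer variable is \<open>\<alpha>\<close> and the
  coefficients are polynomials in \<open>t\<close>.  Hence \<open>F\<^sub>P(a, t)\<close> is
  \<open>poly (face_polynomial P) [:a:]\<close>.  Since only nonempty faces occur, their affine
  dimension is nonnegative and \<open>nat\<close> does not truncate.
\<close>

definition face_polynomial :: "'a::euclidean_space set \<Rightarrow> int poly poly" where
  "face_polynomial P =
     (\<Sum>F | F face_of P \<and> F \<noteq> {}.
        monom (monom 1 (num_facets_containing P F)) (nat (aff_dim F)))"

end

theory Submission
  imports Defs
begin

text \<open>
  The Euler relation \<open>\<Sum>F. (-1) ^ dim F = 1\<close> over the nonempty faces of a polytope follows by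
  induction on the dimension: sweep \<open>P\<close> by the hyperplanes \<open>H\<^sub>c = {x. a \<bullet> x =
  c}\<close>. The nonempty faces of \<open>P \<inter> H\<^sub>c\<close> are the faces of \<open>P\<close>
  inside \<open>H\<^sub>c\<close> and the sections of the faces crossing \<open>H\<^sub>c\<close>, whose
  dimension drops by one. Let \<open>V\<close> be the set of minimal and maximal values of \<open>a\<close> on
  faces, and choose one level in each gap of \<open>V\<close>. A face on which \<open>a\<close> is not
  constant crosses exactly one more gap level than levels of \<open>V\<close>, so summing the induction
  hypothesis over \<open>V\<close> and subtracting its sum over the gap levels counts every face of
  \<open>P\<close> once with its sign, giving \<open>card V - (card V - 1) = 1\<close>.

  The coefficient of \<open>t\<^sup>k\<close> in \<open>F\<^sub>P(-1, t + 1)\<close> is \<open>\<Sum>F. (-1) ^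
  dim F * (m(F) choose k)\<close>. Writing the binomial as the number of \<open>k\<close>-sets
  \<open>S\<close> of facets containing \<open>F\<close> and exchanging sums, the Euler relation for the face
  \<open>P \<inter> \<Inter>S\<close> shows that it counts the \<open>k\<close>-sets \<open>S\<close> of
  facets with \<open>P \<inter> \<Inter>S \<noteq> {}\<close>. The map sending a face to the set of facets
  containing it is injective into these sets, and onto for \<open>k \<le> 1\<close>.
\<close>

text \<open>The empty set has no nonempty faces, so its sum is 0; every nonempty polytope will turn
  out to give 1.\<close>

definition face_euler_sum :: "'a::euclidean_space set \<Rightarrow> int" where
  "face_euler_sum S = (\<Sum>F | F face_of S \<and> F \<noteq> {}. (-1) ^ nat (aff_dim F))"

subsection \<open>Slices of polytopes\<close>

text \<open>\<open>rel_interior S \<inter> T\<close> is nonempty and relatively open in the affine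
  set \<open>affine hull S \<inter> T\<close>, so it already spans that set. A \<open>T\<close> that
  only touches the boundary of \<open>S\<close> could give a smaller hull.\<close>

lemma affine_hull_convex_Int_affine:
  fixes S T :: "'a::euclidean_space set"
  assumes "convex S" "affine T" and ne: "rel_interior S \<inter> T \<noteq> {}"
  shows "affine hull (S \<inter> T) = affine hull S \<inter> T"
proof -
  have aff: "affine (affine hull S \<inter> T)"
    by (simp add: affine_Int assms(2))
  then have hh: "affine hull (affine hull S \<inter> T) = affine hull S \<inter> T"
    by (simp only: affine_hull_eq)
  obtain W where W: "open W" "rel_interior S = affine hull S \<inter> W"
    using rel_interior[of S] openin_rel_interior[of S] by (auto simp: openin_open)
  then have "rel_interior S \<inter> T = (affine hull S \<inter> T) \<inter> W" by blast
  then have "openin (top_of_set (affine hull (affine hull S \<inter> T))) (rel_interior S \<inter> T)"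
    unfolding hh openin_open using W(1) by blast
  then have "affine hull (rel_interior S \<inter> T) = affine hull S \<inter> T"
    using affine_hull_openin[OF _ ne] hh by metis
  moreover have "affine hull (rel_interior S \<inter> T) \<subseteq> affine hull (S \<inter> T)"
    by (intro hull_mono Int_mono rel_interior_subset order_refl)
  moreover have "affine hull (S \<inter> T) \<subseteq> affine hull S \<inter> T"
    by (intro hull_minimal aff Int_mono hull_subset order_refl)
  ultimately show ?thesis by blast
qed

lemma rel_interior_Int_affine:
  fixes S T :: "'a::euclidean_space set"
  assumes "convex S" "affine T" "rel_interior S \<inter> T \<noteq> {}"
  shows "rel_interior (S \<inter> T) = rel_interior S \<inter> T"
  using convex_rel_interior_inter_two[of S T] assms
  by (simp add: affine_imp_convex rel_interior_affine)

text \<open>The smallest face containing \<open>x\<close> works: were \<open>x\<close> outside its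
  relative interior, a facet of it would be a strictly smaller face of \<open>P\<close> through
  \<open>x\<close>.\<close>

lemma polytope_point_in_rel_interior_face:
  fixes P :: "'a::euclidean_space set"
  assumes "polytope P" "x \<in> P"
  obtains F where "F face_of P" "x \<in> rel_interior F"
proof -
  let ?A = "{F. F face_of P \<and> x \<in> F}"
  have "?A \<noteq> {}" using assms face_of_refl polytope_imp_convex by blast
  then have f: "\<Inter>?A face_of P" by (intro face_of_Inter) auto
  have "x \<in> rel_interior (\<Inter>?A)"
  proof (rule ccontr)
    assume n: "x \<notin> rel_interior (\<Inter>?A)"
    have "polyhedron (\<Inter>?A)"
      using f assms(1) face_of_polytope_polytope polytope_imp_polyhedron by blast
    with n obtain G where G: "G facet_of (\<Inter>?A)" "x \<in> G"
      by (auto simp: rel_interior_of_polyhedron)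
    then have "G face_of P" using face_of_trans[OF facet_of_imp_face_of f] by blast
    then have "\<Inter>?A \<subseteq> G" using G(2) by blast
    then show False using G facet_of_imp_subset facet_of_irrefl by (metis subset_antisym)
  qed
  with f that show ?thesis by blast
qed

text \<open>Distinct faces have disjoint relative interiors, so one relative interior point
  determines a face. This gives injectivity, and recovers from a face of the slice the face of
  \<open>P\<close> that cuts it out.\<close>

lemma bij_betw_faces_slice:
  fixes P T :: "'a::euclidean_space set"
  assumes P: "polytope P" and T: "affine T"
  shows "bij_betw (\<lambda>F. F \<inter> T) {F. F face_of P \<and> rel_interior F \<inter> T \<noteq> {}}
           {G. G face_of (P \<inter> T) \<and> G \<noteq> {}}"
proof -
  have ri: "rel_interior (F \<inter> T) = rel_interior F \<inter> T"
    if "F face_of P" "rel_interior F \<inter> T \<noteq> {}" for F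
    using that T face_of_imp_convex rel_interior_Int_affine by blast
  have "inj_on (\<lambda>F. F \<inter> T) {F. F face_of P \<and> rel_interior F \<inter> T \<noteq> {}}"
  proof (rule inj_onI, clarify)
    fix F F'
    assume F: "F face_of P" "rel_interior F \<inter> T \<noteq> {}"
      and F': "F' face_of P" "rel_interior F' \<inter> T \<noteq> {}" and eq: "F \<inter> T = F' \<inter> T"
    have "rel_interior F \<inter> T = rel_interior F' \<inter> T"
      using ri[OF F] ri[OF F'] eq by simp
    then have "rel_interior F \<inter> rel_interior F' \<noteq> {}" using F(2) by blast
    then show "F = F'" using F(1) F'(1) face_of_eq by blast
  qed
  moreover have "(\<lambda>F. F \<inter> T) ` {F. F face_of P \<and> rel_interior F \<inter> T \<noteq> {}}
      = {G. G face_of (P \<inter> T) \<and> G \<noteq> {}}"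
  proof (intro subset_antisym subsetI)
    fix G assume "G \<in> (\<lambda>F. F \<inter> T) ` {F. F face_of P \<and> rel_interior F \<inter> T \<noteq> {}}"
    then show "G \<in> {G. G face_of (P \<inter> T) \<and> G \<noteq> {}}"
      using T affine_imp_convex face_of_slice rel_interior_subset by fastforce
  next
    fix G assume "G \<in> {G. G face_of (P \<inter> T) \<and> G \<noteq> {}}"
    then have G: "G face_of (P \<inter> T)" "G \<noteq> {}" by auto
    then obtain x where x: "x \<in> rel_interior G"
      by (metis equals0I face_of_imp_convex rel_interior_eq_empty)
    then have xPT: "x \<in> P" "x \<in> T"
      using G(1) face_of_imp_subset rel_interior_subset by blast+
    obtain F where F: "F face_of P" "x \<in> rel_interior F"
      using polytope_point_in_rel_interior_face[OF P xPT(1)] by blast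
    have ne: "rel_interior F \<inter> T \<noteq> {}" using F xPT by blast
    have "x \<in> rel_interior (F \<inter> T)" using ri[OF F(1) ne] F xPT by blast
    moreover have "F \<inter> T face_of P \<inter> T"
      using F(1) T affine_imp_convex face_of_slice by blast
    ultimately have "G = F \<inter> T" using face_of_eq[OF G(1)] x by blast
    then show "G \<in> (\<lambda>F. F \<inter> T) ` {F. F face_of P \<and> rel_interior F \<inter> T \<noteq> {}}"
      using F(1) ne by blast
  qed
  ultimately show ?thesis by (simp add: bij_betw_def)
qed

text \<open>If \<open>F\<close> lies on one side of the hyperplane, its contact set is a face of
  \<open>F\<close>, and a face meeting the relative interior is all of \<open>F\<close>. The
  converse for a crossing \<open>F\<close> is the intermediate value theorem on the connected set
  \<open>rel_interior F\<close>.\<close>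

lemma rel_interior_meets_hyperplane_iff:
  fixes F :: "'a::euclidean_space set"
  assumes "convex F" "F \<noteq> {}"
  shows "rel_interior F \<inter> {x. a \<bullet> x = c} \<noteq> {} \<longleftrightarrow>
      F \<subseteq> {x. a \<bullet> x = c} \<or> (\<exists>x\<in>F. \<exists>y\<in>F. a \<bullet> x < c \<and> c < a \<bullet> y)"
proof (intro iffI disjCI)
  assume ne: "rel_interior F \<inter> {x. a \<bullet> x = c} \<noteq> {}"
    and "\<not> (\<exists>x\<in>F. \<exists>y\<in>F. a \<bullet> x < c \<and> c < a \<bullet> y)"
  then consider "\<And>x. x \<in> F \<Longrightarrow> a \<bullet> x \<ge> c" | "\<And>x. x \<in> F \<Longrightarrow> a \<bullet> x \<le> c"
    by (meson not_le)
  then have "F \<inter> {x. a \<bullet> x = c} face_of F"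
    by cases (use assms face_of_Int_supporting_hyperplane_ge face_of_Int_supporting_hyperplane_le
        in blast)+
  then have "F \<subseteq> F \<inter> {x. a \<bullet> x = c}"
    by (rule subset_of_face_of) (use ne rel_interior_subset in blast)+
  then show "F \<subseteq> {x. a \<bullet> x = c}" by blast
next
  assume "F \<subseteq> {x. a \<bullet> x = c} \<or> (\<exists>x\<in>F. \<exists>y\<in>F. a \<bullet> x < c \<and> c < a \<bullet> y)"
  then show "rel_interior F \<inter> {x. a \<bullet> x = c} \<noteq> {}"
  proof
    assume "F \<subseteq> {x. a \<bullet> x = c}"
    then show ?thesis using assms rel_interior_eq_empty rel_interior_subset by blast
  next
    assume "\<exists>x\<in>F. \<exists>y\<in>F. a \<bullet> x < c \<and> c < a \<bullet> y"
    \<comment> \<open>By density and openness of the two half-spaces, the points on either side can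
      be chosen in the relative interior.\<close>
    moreover have "F \<subseteq> closure (rel_interior F)"
      using assms(1) closure_subset convex_closure_rel_interior by blast
    ultimately have "{x. a \<bullet> x < c} \<inter> closure (rel_interior F) \<noteq> {}"
      "{x. a \<bullet> x > c} \<inter> closure (rel_interior F) \<noteq> {}" by blast+
    then have "{x. a \<bullet> x < c} \<inter> rel_interior F \<noteq> {}" "{x. a \<bullet> x > c} \<inter> rel_interior F \<noteq> {}"
      by (simp_all add: open_Int_closure_eq_empty open_halfspace_lt open_halfspace_gt)
    then obtain x y where "x \<in> rel_interior F" "a \<bullet> x < c" "y \<in> rel_interior F" "c < a \<bullet> y"
      by blast
    moreover have "connected (rel_interior F)"
      by (simp add: assms(1) convex_connected convex_rel_interior)
    ultimately obtain z where "z \<in> rel_interior F" "a \<bullet> z = c"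
      using connected_ivt_hyperplane[of "rel_interior F" x y a c] by auto
    then show ?thesis by blast
  qed
qed

text \<open>The drop by exactly one is the affine fact for \<open>affine hull F\<close>; it
  transfers because the hyperplane meets the relative interior.\<close>

lemma aff_dim_Int_crossing_hyperplane:
  fixes F :: "'a::euclidean_space set"
  assumes "convex F" "rel_interior F \<inter> {x. a \<bullet> x = c} \<noteq> {}" "\<not> F \<subseteq> {x. a \<bullet> x = c}"
  shows "aff_dim (F \<inter> {x. a \<bullet> x = c}) = aff_dim F - 1"
proof -
  have "affine hull F \<inter> {x. a \<bullet> x = c} \<noteq> {}"
    using assms(2) rel_interior_subset[of F] hull_subset[of F affine] by blast
  moreover have "\<not> affine hull F \<subseteq> {x. a \<bullet> x = c}"
    using assms(3) hull_subset[of F affine] by blast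
  ultimately have "aff_dim (affine hull F \<inter> {x. a \<bullet> x = c}) = aff_dim F - 1"
    by (simp add: aff_dim_affine_Int_hyperplane)
  then show ?thesis
    using affine_hull_convex_Int_affine[OF assms(1) affine_hyperplane assms(2)]
      aff_dim_affine_hull[of "F \<inter> {x. a \<bullet> x = c}"] by simp
qed

lemma finite_nonempty_faces:
  fixes P :: "'a::euclidean_space set"
  shows "polytope P \<Longrightarrow> finite {F. F face_of P \<and> F \<noteq> {}}"
  by (rule finite_subset[OF _ finite_polytope_faces[of P]]) auto

text \<open>A face inside the hyperplane keeps its sign, a crossing face loses one dimension and so
  flips its sign, and the relative interior of any other face misses the hyperplane, so it yields no
  face of the slice.\<close>

lemma face_euler_sum_Int_hyperplane:
  fixes P :: "'a::euclidean_space set"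
  assumes P: "polytope P"
  shows "face_euler_sum (P \<inter> {x. a \<bullet> x = c}) =
    (\<Sum>F | F face_of P \<and> F \<noteq> {}.
       if F \<subseteq> {x. a \<bullet> x = c} then (-1) ^ nat (aff_dim F)
       else if \<exists>x\<in>F. \<exists>y\<in>F. a \<bullet> x < c \<and> c < a \<bullet> y then - ((-1) ^ nat (aff_dim F)) else 0)"
    (is "_ = sum ?w _")
proof -
  let ?H = "{x. a \<bullet> x = c}"
  let ?R = "{F. F face_of P \<and> rel_interior F \<inter> ?H \<noteq> {}}"
  have "face_euler_sum (P \<inter> ?H) = (\<Sum>F\<in>?R. (-1) ^ nat (aff_dim (F \<inter> ?H)))"
    unfolding face_euler_sum_def
    by (rule sum.reindex_bij_betw[symmetric, OF bij_betw_faces_slice[OF P affine_hyperplane]])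
  also have "\<dots> = sum ?w ?R"
  proof (rule sum.cong, simp)
    fix F assume "F \<in> ?R"
    then have F: "F face_of P" "rel_interior F \<inter> ?H \<noteq> {}" by auto
    have cF: "convex F" using F(1) face_of_imp_convex by blast
    have neF: "F \<noteq> {}" using F(2) rel_interior_subset by blast
    show "(-1) ^ nat (aff_dim (F \<inter> ?H)) = ?w F"
    proof (cases "F \<subseteq> ?H")
      case True
      then show ?thesis by (simp add: Int_absorb2)
    next
      case False
      have d: "aff_dim (F \<inter> ?H) = aff_dim F - 1"
        by (rule aff_dim_Int_crossing_hyperplane[OF cF F(2) False])
      \<comment> \<open>Nonemptiness keeps the dimension of the section nonnegative, so
        \<open>nat\<close> does not truncate.\<close>
      have "F \<inter> ?H \<noteq> {}" using F(2) rel_interior_subset by blast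
      then have "aff_dim (F \<inter> ?H) \<ge> 0" by (metis aff_dim_negative_iff not_less)
      then have "nat (aff_dim F) = Suc (nat (aff_dim (F \<inter> ?H)))" using d by simp
      moreover have "\<exists>x\<in>F. \<exists>y\<in>F. a \<bullet> x < c \<and> c < a \<bullet> y"
        using rel_interior_meets_hyperplane_iff[OF cF neF, of a c] F(2) False by blast
      ultimately show ?thesis using False by simp
    qed
  qed
  also have "\<dots> = sum ?w {F. F face_of P \<and> F \<noteq> {}}"
  proof (rule sum.mono_neutral_left)
    show "finite {F. F face_of P \<and> F \<noteq> {}}" by (rule finite_nonempty_faces[OF P])
    show "?R \<subseteq> {F. F face_of P \<and> F \<noteq> {}}" using rel_interior_subset by fastforce
    show "\<forall>F\<in>{F. F face_of P \<and> F \<noteq> {}} - ?R. ?w F = 0"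
    proof
      fix F assume "F \<in> {F. F face_of P \<and> F \<noteq> {}} - ?R"
      then have "convex F" "F \<noteq> {}" "rel_interior F \<inter> ?H = {}"
        using face_of_imp_convex by auto
      then have "\<not> F \<subseteq> ?H \<and> \<not> (\<exists>x\<in>F. \<exists>y\<in>F. a \<bullet> x < c \<and> c < a \<bullet> y)"
        using rel_interior_meets_hyperplane_iff[of F a c] by blast
      then show "?w F = 0" by simp
    qed
  qed
  finally show ?thesis .
qed

subsection \<open>The Euler relation\<close>

lemma compact_inner_Inf_Sup:
  fixes F :: "'a::euclidean_space set"
  assumes "compact F" "F \<noteq> {}"
  shows "\<exists>x\<in>F. a \<bullet> x = Inf ((\<bullet>) a ` F)" "\<exists>x\<in>F. a \<bullet> x = Sup ((\<bullet>) a ` F)"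
    "\<And>x. x \<in> F \<Longrightarrow> Inf ((\<bullet>) a ` F) \<le> a \<bullet> x" "\<And>x. x \<in> F \<Longrightarrow> a \<bullet> x \<le> Sup ((\<bullet>) a ` F)"
proof -
  have c: "compact ((\<bullet>) a ` F)"
    by (intro compact_continuous_image assms continuous_intros)
  then have b: "bdd_below ((\<bullet>) a ` F)" "bdd_above ((\<bullet>) a ` F)"
    by (simp_all add: bounded_imp_bdd_below bounded_imp_bdd_above compact_imp_bounded)
  have "Inf ((\<bullet>) a ` F) \<in> (\<bullet>) a ` F" "Sup ((\<bullet>) a ` F) \<in> (\<bullet>) a ` F"
    using c b assms(2) closed_contains_Inf[of "(\<bullet>) a ` F"] closed_contains_Sup[of "(\<bullet>) a ` F"]
    by (auto simp: compact_imp_closed)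
  then show "\<exists>x\<in>F. a \<bullet> x = Inf ((\<bullet>) a ` F)" "\<exists>x\<in>F. a \<bullet> x = Sup ((\<bullet>) a ` F)"
    by force+
  show "\<And>x. x \<in> F \<Longrightarrow> Inf ((\<bullet>) a ` F) \<le> a \<bullet> x" "\<And>x. x \<in> F \<Longrightarrow> a \<bullet> x \<le> Sup ((\<bullet>) a ` F)"
    using b by (auto intro: cInf_lower cSup_upper)
qed

text \<open>The witness is the midpoint between \<open>v\<close> and its successor in
  \<open>V\<close>. The bound by \<open>Max V\<close> later ensures that this level is attained on
  \<open>P\<close>.\<close>

lemma finite_linorder_gap:
  fixes V :: "real set"
  assumes "finite V" "v \<in> V" "v \<noteq> Max V"
  shows "\<exists>m. v < m \<and> m \<le> Max V \<and> (\<forall>w\<in>V. w \<le> v \<or> m < w)"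
proof -
  let ?W = "{w \<in> V. v < w}"
  have "v < Max V" using assms by (meson Max_ge order_neq_le_trans)
  then have W: "finite ?W" "Max V \<in> ?W" using assms Max_in by auto
  then have "Min ?W \<in> ?W" by (intro Min_in) auto
  then have "v < Min ?W" by blast
  then have lt: "v < (v + Min ?W) / 2" "(v + Min ?W) / 2 < Min ?W" by simp_all
  have le: "Min ?W \<le> w" if "w \<in> V" "v < w" for w using W(1) that by simp
  have "Min ?W \<le> Max V" using W by simp
  with lt have "(v + Min ?W) / 2 \<le> Max V" by linarith
  moreover have "\<forall>w\<in>V. w \<le> v \<or> (v + Min ?W) / 2 < w"
  proof
    fix w assume "w \<in> V"
    show "w \<le> v \<or> (v + Min ?W) / 2 < w"
      using le[OF \<open>w \<in> V\<close>] lt by linarith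
  qed
  ultimately show ?thesis using lt(1) by blast
qed

text \<open>Strong induction on the dimension, with single points as base case. All slices used are
  nonempty, so the induction hypothesis applies to each.\<close>

theorem Euler_Poincare_polytope:
  fixes P :: "'a::euclidean_space set"
  assumes "polytope P" "P \<noteq> {}"
  shows "face_euler_sum P = 1"
  using assms
proof (induction "nat (aff_dim P)" arbitrary: P rule: less_induct)
  case less
  note P = less.prems(1)
  show ?case
  proof (cases "\<exists>x\<in>P. \<exists>y\<in>P. x \<noteq> y")
    case False
    then obtain p where p: "P = {p}" using less.prems(2) by blast
    have "{F. F face_of P \<and> F \<noteq> {}} = {{p}}"
      using p face_of_refl[of P] face_of_imp_subset by fastforce
    then show ?thesis by (simp add: face_euler_sum_def)
  next
    case True
    then obtain x y where xy: "x \<in> P" "y \<in> P" "x \<noteq> y" by blast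
    \<comment> \<open>This direction takes different values at \<open>x\<close> and
      \<open>y\<close>, so no level hyperplane contains \<open>P\<close> and every slice has smaller
      dimension.\<close>
    define a where "a = y - x"
    have axy: "a \<bullet> x \<noteq> a \<bullet> y"
      using xy(3) inner_eq_zero_iff[of "y - x"] by (auto simp: a_def inner_diff_right)
    define \<F> where "\<F> = {F. F face_of P \<and> F \<noteq> {}}"
    define lo where "lo F = Inf ((\<bullet>) a ` F)" for F
    define hi where "hi F = Sup ((\<bullet>) a ` F)" for F
    define \<sigma> :: "'a set \<Rightarrow> int" where "\<sigma> F = (-1) ^ nat (aff_dim F)" for F
    have fin: "finite \<F>" unfolding \<F>_def by (rule finite_nonempty_faces[OF P])
    have cpt: "compact F" if "F \<in> \<F>" for F
      using that P face_of_polytope_polytope polytope_imp_compact unfolding \<F>_def by blast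
    have ne: "F \<noteq> {}" if "F \<in> \<F>" for F using that by (simp add: \<F>_def)
    have sub: "F \<subseteq> P" if "F \<in> \<F>" for F using that face_of_imp_subset by (auto simp: \<F>_def)
    note ext = compact_inner_Inf_Sup[where a = a, OF cpt ne, folded lo_def hi_def]
    have PF: "P \<in> \<F>" using P less.prems(2) by (simp add: \<F>_def face_of_refl polytope_imp_convex)
    define V where "V = lo ` \<F> \<union> hi ` \<F>"
    have finV: "finite V" using fin by (simp add: V_def)
    have attained: "\<exists>x\<in>P. a \<bullet> x = v" if "v \<in> V" for v
      using that ext(1,2) sub unfolding V_def by blast
    have neV: "V \<noteq> {}" using PF by (auto simp: V_def)
    have lohi: "lo F \<le> hi F" if "F \<in> \<F>" for F
      using ext[OF that that] by fastforce
    have slice1: "face_euler_sum (P \<inter> {x. a \<bullet> x = c}) = 1" if c: "\<exists>x\<in>P. a \<bullet> x = c" for c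
    proof (rule less.hyps)
      show "polytope (P \<inter> {x. a \<bullet> x = c})"
        by (simp add: P polytope_Int_polyhedron polyhedron_hyperplane)
      show n: "P \<inter> {x. a \<bullet> x = c} \<noteq> {}" using c by blast
      have "\<not> affine hull P \<subseteq> {x. a \<bullet> x = c}"
        using xy(1,2) axy hull_subset[of P affine] by blast
      moreover have "affine hull P \<inter> {x. a \<bullet> x = c} \<noteq> {}"
        using n hull_subset[of P affine] by blast
      ultimately have "aff_dim (affine hull P \<inter> {x. a \<bullet> x = c}) = aff_dim P - 1"
        by (simp add: aff_dim_affine_Int_hyperplane)
      moreover have "aff_dim (P \<inter> {x. a \<bullet> x = c}) \<le> aff_dim (affine hull P \<inter> {x. a \<bullet> x = c})"
        by (intro aff_dim_subset Int_mono hull_subset order_refl)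
      moreover have "0 \<le> aff_dim (P \<inter> {x. a \<bullet> x = c})" using n by (metis aff_dim_negative_iff not_less)
      ultimately show "nat (aff_dim (P \<inter> {x. a \<bullet> x = c})) < nat (aff_dim P)" by linarith
    qed
    \<comment> \<open>The induction hypothesis in terms of extreme values: \<open>F\<close> lies in
      the hyperplane when both equal \<open>c\<close>, and crosses it when \<open>c\<close> is
      strictly between them.\<close>
    have slice: "1 = (\<Sum>F\<in>\<F>. if lo F = c \<and> hi F = c then \<sigma> F
        else if lo F < c \<and> c < hi F then - \<sigma> F else 0)" if c: "\<exists>x\<in>P. a \<bullet> x = c" for c
    proof -
      have flat: "F \<subseteq> {x. a \<bullet> x = c} \<longleftrightarrow> lo F = c \<and> hi F = c"
        and cross: "(\<exists>x\<in>F. \<exists>y\<in>F. a \<bullet> x < c \<and> c < a \<bullet> y) \<longleftrightarrow> lo F < c \<and> c < hi F"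
        if F: "F \<in> \<F>" for F
      proof -
        obtain u w where u: "u \<in> F" "a \<bullet> u = lo F" and w: "w \<in> F" "a \<bullet> w = hi F"
          using ext(1,2)[OF F F] by blast
        note b = ext(3,4)[OF F F]
        show "F \<subseteq> {x. a \<bullet> x = c} \<longleftrightarrow> lo F = c \<and> hi F = c"
          using u w b by fastforce
        show "(\<exists>x\<in>F. \<exists>y\<in>F. a \<bullet> x < c \<and> c < a \<bullet> y) \<longleftrightarrow> lo F < c \<and> c < hi F"
          using u w b by (metis le_less_trans less_le_trans)
      qed
      have "1 = face_euler_sum (P \<inter> {x. a \<bullet> x = c})" by (rule slice1[OF c, symmetric])
      also have "\<dots> = (\<Sum>F\<in>\<F>. if lo F = c \<and> hi F = c then \<sigma> F
          else if lo F < c \<and> c < hi F then - \<sigma> F else 0)"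
        unfolding face_euler_sum_Int_hyperplane[OF P] \<F>_def[symmetric]
        by (rule sum.cong[OF refl]) (simp only: flat cross \<sigma>_def)
      finally show ?thesis .
    qed
    \<comment> \<open>Each gap of \<open>V\<close> is indexed by its lower end, so the top value
      indexes none; \<open>m v\<close> is the level chosen in the gap above
      \<open>v\<close>.\<close>
    let ?V' = "V - {Max V}"
    have "\<exists>m. \<forall>v\<in>?V'. v < m v \<and> m v \<le> Max V \<and> (\<forall>w\<in>V. w \<le> v \<or> m v < w)"
      using finite_linorder_gap[OF finV] by (intro bchoice) blast
    then obtain m where m: "\<And>v. v \<in> ?V' \<Longrightarrow> v < m v" "\<And>v. v \<in> ?V' \<Longrightarrow> m v \<le> Max V"
      "\<And>v w. v \<in> ?V' \<Longrightarrow> w \<in> V \<Longrightarrow> w \<le> v \<or> m v < w"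
      by metis
    have mid: "\<exists>x\<in>P. a \<bullet> x = m v" if v: "v \<in> ?V'" for v
    proof -
      obtain x where "x \<in> P" "a \<bullet> x = v" using attained v by blast
      moreover obtain y where "y \<in> P" "a \<bullet> y = Max V" using attained Max_in[OF finV neV] by blast
      moreover have "connected P" using P by (simp add: convex_connected polytope_imp_convex)
      ultimately show ?thesis
        using connected_ivt_hyperplane[of P x y a "m v"] m(1,2)[OF v] by auto
    qed
    \<comment> \<open>Sum of the slices over \<open>V\<close>. A face with constant \<open>a\<close>
      contributes at one level only, which lies in \<open>V\<close>; any other face contributes at
      each value strictly between its extremes.\<close>
    have A: "int (card V) = (\<Sum>F\<in>\<F>. if lo F = hi F then \<sigma> F
        else - \<sigma> F * int (card {v \<in> V. lo F < v \<and> v < hi F}))"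
    proof -
      have "int (card V) = (\<Sum>c\<in>V. 1)" by simp
      also have "\<dots> = (\<Sum>c\<in>V. \<Sum>F\<in>\<F>. if lo F = c \<and> hi F = c then \<sigma> F
        else if lo F < c \<and> c < hi F then - \<sigma> F else 0)"
        by (intro sum.cong refl slice attained)
      also have "\<dots> = (\<Sum>F\<in>\<F>. \<Sum>c\<in>V. if lo F = c \<and> hi F = c then \<sigma> F
        else if lo F < c \<and> c < hi F then - \<sigma> F else 0)"
        by (rule sum.swap)
      also have "\<dots> = (\<Sum>F\<in>\<F>. if lo F = hi F then \<sigma> F
        else - \<sigma> F * int (card {v \<in> V. lo F < v \<and> v < hi F}))"
      proof (rule sum.cong[OF refl])
        fix F assume F: "F \<in> \<F>"
        show "(\<Sum>c\<in>V. if lo F = c \<and> hi F = c then \<sigma> F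
            else if lo F < c \<and> c < hi F then - \<sigma> F else 0) =
          (if lo F = hi F then \<sigma> F
           else - \<sigma> F * int (card {v \<in> V. lo F < v \<and> v < hi F}))"
        proof (cases "lo F = hi F")
          case True
          then have "(\<Sum>c\<in>V. if lo F = c \<and> hi F = c then \<sigma> F
              else if lo F < c \<and> c < hi F then - \<sigma> F else 0) = (\<Sum>c\<in>V. if hi F = c then \<sigma> F else 0)"
            by (intro sum.cong) auto
          also have "\<dots> = \<sigma> F" using finV F by (simp add: V_def)
          finally show ?thesis using True by simp
        next
          case False
          then have "(\<Sum>c\<in>V. if lo F = c \<and> hi F = c then \<sigma> F
              else if lo F < c \<and> c < hi F then - \<sigma> F else 0) =
              (\<Sum>c\<in>V. if lo F < c \<and> c < hi F then - \<sigma> F else 0)"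
            by (intro sum.cong) auto
          also have "\<dots> = (\<Sum>c\<in>{v \<in> V. lo F < v \<and> v < hi F}. - \<sigma> F)"
            by (rule sum.inter_filter[OF finV, symmetric])
          finally show ?thesis using False by simp
        qed
      qed
      finally show ?thesis .
    qed
    \<comment> \<open>Sum of the slices over the gap levels. These avoid \<open>V\<close>, so no
      face is flat at such a level; and \<open>m v\<close> is strictly between the extremes of
      \<open>F\<close> exactly when \<open>lo F \<le> v < hi F\<close>.\<close>
    have B: "int (card ?V') = (\<Sum>F\<in>\<F>. if lo F = hi F then 0
        else - \<sigma> F * int (card {v \<in> V. lo F \<le> v \<and> v < hi F}))"
    proof -
      have "int (card ?V') = (\<Sum>v\<in>?V'. 1)" by simp
      also have "\<dots> = (\<Sum>v\<in>?V'. \<Sum>F\<in>\<F>. if lo F = m v \<and> hi F = m v then \<sigma> F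
        else if lo F < m v \<and> m v < hi F then - \<sigma> F else 0)"
        by (intro sum.cong refl slice mid)
      also have "\<dots> = (\<Sum>F\<in>\<F>. \<Sum>v\<in>?V'. if lo F = m v \<and> hi F = m v then \<sigma> F
        else if lo F < m v \<and> m v < hi F then - \<sigma> F else 0)"
        by (rule sum.swap)
      also have "\<dots> = (\<Sum>F\<in>\<F>. if lo F = hi F then 0
        else - \<sigma> F * int (card {v \<in> V. lo F \<le> v \<and> v < hi F}))"
      proof (rule sum.cong[OF refl])
        fix F assume F: "F \<in> \<F>"
        then have FV: "lo F \<in> V" "hi F \<in> V" by (auto simp: V_def)
        have hm: "hi F \<le> Max V" using FV finV by simp
        have l: "lo F < m v \<longleftrightarrow> lo F \<le> v" "lo F \<noteq> m v" if "v \<in> ?V'" for v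
          using m(1)[OF that] m(3)[OF that FV(1)] by auto
        have h: "m v < hi F \<longleftrightarrow> v < hi F" if "v \<in> ?V'" for v
          using m(1)[OF that] m(3)[OF that FV(2)] by auto
        have "(\<Sum>v\<in>?V'. if lo F = m v \<and> hi F = m v then \<sigma> F
            else if lo F < m v \<and> m v < hi F then - \<sigma> F else 0) =
           (\<Sum>v\<in>?V'. if lo F \<le> v \<and> v < hi F then - \<sigma> F else 0)"
          by (intro sum.cong refl) (simp add: l h)
        also have "\<dots> = (\<Sum>v\<in>{v \<in> ?V'. lo F \<le> v \<and> v < hi F}. - \<sigma> F)"
          by (rule sum.inter_filter[symmetric]) (simp add: finV)
        \<comment> \<open>Any \<open>v < hi F\<close> is below \<open>Max V\<close>, so the removed
          value does not affect this set.\<close>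
        also have "{v \<in> ?V'. lo F \<le> v \<and> v < hi F} = {v \<in> V. lo F \<le> v \<and> v < hi F}"
          using hm by auto
        also have "(\<Sum>v\<in>\<dots>. - \<sigma> F) = (if lo F = hi F then 0
            else - \<sigma> F * int (card {v \<in> V. lo F \<le> v \<and> v < hi F}))"
        proof (cases "lo F = hi F")
          case True
          then have empty: "{v \<in> V. lo F \<le> v \<and> v < hi F} = {}" by auto
          show ?thesis unfolding empty using True by simp
        qed simp
        finally show "(\<Sum>v\<in>?V'. if lo F = m v \<and> hi F = m v then \<sigma> F
            else if lo F < m v \<and> m v < hi F then - \<sigma> F else 0) =
          (if lo F = hi F then 0 else - \<sigma> F * int (card {v \<in> V. lo F \<le> v \<and> v < hi F}))" .
      qed
      finally show ?thesis .
    qed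
    have "int (card V) - int (card ?V') = (\<Sum>F\<in>\<F>. \<sigma> F)"
      unfolding A B sum_subtractf[symmetric]
    proof (rule sum.cong[OF refl])
      fix F assume F: "F \<in> \<F>"
      \<comment> \<open>The half-open interval gains only \<open>lo F\<close>: this single extra
        crossing leaves exactly one \<open>\<sigma> F\<close> in the difference.\<close>
      have "card {v \<in> V. lo F \<le> v \<and> v < hi F} = Suc (card {v \<in> V. lo F < v \<and> v < hi F})"
        if "lo F \<noteq> hi F"
      proof -
        have "{v \<in> V. lo F \<le> v \<and> v < hi F} = insert (lo F) {v \<in> V. lo F < v \<and> v < hi F}"
          using that lohi[OF F] F by (auto simp: V_def)
        then show ?thesis using finV by simp
      qed
      then show "(if lo F = hi F then \<sigma> F
          else - \<sigma> F * int (card {v \<in> V. lo F < v \<and> v < hi F})) -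
        (if lo F = hi F then 0 else - \<sigma> F * int (card {v \<in> V. lo F \<le> v \<and> v < hi F})) = \<sigma> F"
        by (simp add: algebra_simps)
    qed
    moreover have "int (card V) - int (card ?V') = 1"
      using card_Suc_Diff1[OF finV Max_in[OF finV neV]] by simp
    ultimately show ?thesis by (simp add: face_euler_sum_def \<F>_def \<sigma>_def)
  qed
qed

subsection \<open>Coefficients of the face polynomial\<close>

lemma coeff_face_polynomial_one:
  fixes P :: "'a::euclidean_space set"
  assumes "polytope P"
  shows "coeff (poly (face_polynomial P) 1) k =
    int (card {F. F face_of P \<and> F \<noteq> {} \<and> num_facets_containing P F = k})"
proof -
  have "coeff (poly (face_polynomial P) 1) k =
      (\<Sum>F | F face_of P \<and> F \<noteq> {}. if num_facets_containing P F = k then 1 else 0)"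
    by (simp add: face_polynomial_def poly_sum poly_monom coeff_sum)
  also have "\<dots> = int (card {F \<in> {F. F face_of P \<and> F \<noteq> {}}. num_facets_containing P F = k})"
    using finite_nonempty_faces[OF assms] by (simp flip: sum.inter_filter)
  finally show ?thesis by (simp add: conj_assoc)
qed

lemma pcompose_monom_one: "pcompose (monom (1::int) n) p = p ^ n"
proof (induction n)
  case 0
  show ?case by (simp only: monom_0 pcompose_const power_0 one_pCons)
next
  case (Suc n)
  then show ?case by (simp add: monom_Suc pcompose_pCons)
qed

lemma coeff_one_plus_X_power: "coeff ([:1, 1:] ^ n :: int poly) k = int (n choose k)"
proof (cases "k \<le> n")
  case True
  then show ?thesis by (simp add: coeff_linear_poly_power)
next
  case False
  then have "degree ([:1, 1:] ^ n :: int poly) < k"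
    using degree_linear_power[of "1::int" n] by simp
  then show ?thesis using False by (simp add: coeff_eq_0 binomial_eq_0)
qed

text \<open>Intersecting with \<open>P\<close> matters for \<open>S = {}\<close>, where
  \<open>\<Inter>S\<close> is the whole space: the coefficient for \<open>k = 0\<close> is then 1 or
  0 according to whether \<open>P\<close> is nonempty.\<close>

lemma coeff_pcompose_face_polynomial_minus_one:
  fixes P :: "'a::euclidean_space set"
  assumes P: "polytope P"
  shows "coeff (pcompose (poly (face_polynomial P) (-1)) [:1, 1:]) k =
    int (card {S. S \<subseteq> {G. G facet_of P} \<and> card S = k \<and> P \<inter> \<Inter>S \<noteq> {}})"
proof -
  let ?\<F> = "{F. F face_of P \<and> F \<noteq> {}}"
  let ?X = "{G. G facet_of P}"
  let ?K = "{S. S \<subseteq> ?X \<and> card S = k}"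
  have finX: "finite ?X" by (rule finite_polytope_facets[OF P])
  then have finK: "finite ?K" by (auto intro: finite_subset[of _ "Pow ?X"])
  \<comment> \<open>Evaluation at \<alpha> = -1 leaves the sign as a power of a constant polynomial;
    this turns it into a scalar that commutes with composition and coefficients.\<close>
  have sgn: "q * (-1) ^ d = smult ((-1) ^ d) q" for q :: "int poly" and d
    by (induction d) simp_all
  have "coeff (pcompose (poly (face_polynomial P) (-1)) [:1, 1:]) k =
      (\<Sum>F\<in>?\<F>. (-1) ^ nat (aff_dim F) * int (num_facets_containing P F choose k))"
    by (simp add: face_polynomial_def poly_sum poly_monom coeff_sum pcompose_sum sgn
        pcompose_smult pcompose_monom_one coeff_one_plus_X_power)
  also have "\<dots> = (\<Sum>F\<in>?\<F>. \<Sum>S\<in>?K. if F \<subseteq> P \<inter> \<Inter>S then (-1) ^ nat (aff_dim F) else 0)"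
  proof (rule sum.cong[OF refl])
    fix F assume F: "F \<in> ?\<F>"
    have "num_facets_containing P F choose k =
        card {S. S \<subseteq> {G. G facet_of P \<and> F \<subseteq> G} \<and> card S = k}"
      unfolding num_facets_containing_def
      by (rule n_subsets[symmetric]) (simp add: finX)
    also have "{S. S \<subseteq> {G. G facet_of P \<and> F \<subseteq> G} \<and> card S = k} = {S \<in> ?K. F \<subseteq> P \<inter> \<Inter>S}"
      using F face_of_imp_subset by blast
    finally have "int (num_facets_containing P F choose k) =
        (\<Sum>S\<in>?K. if F \<subseteq> P \<inter> \<Inter>S then 1 else 0)"
      using finK by (simp flip: sum.inter_filter)
    then show "(-1) ^ nat (aff_dim F) * int (num_facets_containing P F choose k) =
        (\<Sum>S\<in>?K. if F \<subseteq> P \<inter> \<Inter>S then (-1) ^ nat (aff_dim F) else 0)"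
      by (auto simp: sum_distrib_left intro: sum.cong)
  qed
  also have "\<dots> = (\<Sum>S\<in>?K. \<Sum>F\<in>?\<F>. if F \<subseteq> P \<inter> \<Inter>S then (-1) ^ nat (aff_dim F) else 0)"
    by (rule sum.swap)
  also have "\<dots> = (\<Sum>S\<in>?K. if P \<inter> \<Inter>S \<noteq> {} then 1 else 0)"
  proof (rule sum.cong[OF refl])
    fix S assume S: "S \<in> ?K"
    \<comment> \<open>Inserting \<open>P\<close> makes the family nonempty, so that
      \<open>S = {}\<close> is covered too.\<close>
    have "\<Inter>(insert P S) face_of P"
      using S P by (intro face_of_Inter) (auto simp: facet_of_imp_face_of face_of_refl polytope_imp_convex)
    then have f: "P \<inter> \<Inter>S face_of P" by simp
    have "(\<Sum>F\<in>?\<F>. if F \<subseteq> P \<inter> \<Inter>S then (-1) ^ nat (aff_dim F) else 0)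
        = (\<Sum>F\<in>{F \<in> ?\<F>. F \<subseteq> P \<inter> \<Inter>S}. (-1) ^ nat (aff_dim F) :: int)"
      by (rule sum.inter_filter[OF finite_nonempty_faces[OF P], symmetric])
    \<comment> \<open>The faces of a face of \<open>P\<close> are the faces of \<open>P\<close>
      contained in it, so the inner sum is an Euler sum.\<close>
    also have "{F \<in> ?\<F>. F \<subseteq> P \<inter> \<Inter>S} = {F. F face_of (P \<inter> \<Inter>S) \<and> F \<noteq> {}}"
      using face_of_face[OF f] by auto
    also have "(\<Sum>F\<in>\<dots>. (-1) ^ nat (aff_dim F)) = face_euler_sum (P \<inter> \<Inter>S)"
      by (simp only: face_euler_sum_def)
    also have "\<dots> = (if P \<inter> \<Inter>S \<noteq> {} then 1 else 0)"
    proof (cases "P \<inter> \<Inter>S = {}")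
      case True
      then show ?thesis by (simp add: face_euler_sum_def)
    next
      case False
      then show ?thesis using Euler_Poincare_polytope face_of_polytope_polytope[OF P f] by simp
    qed
    finally show "(\<Sum>F\<in>?\<F>. if F \<subseteq> P \<inter> \<Inter>S then (-1) ^ nat (aff_dim F) else 0) =
        (if P \<inter> \<Inter>S \<noteq> {} then 1 else (0::int))" .
  qed
  also have "\<dots> = int (card {S \<in> ?K. P \<inter> \<Inter>S \<noteq> {}})"
    using finK by (simp flip: sum.inter_filter)
  finally show ?thesis by (simp add: conj_assoc)
qed

text \<open>A proper nonempty face of a polyhedron is the intersection of the facets above it; the
  factor \<open>P\<close> handles \<open>F = P\<close>, which lies in no facet. Hence a face can be
  recovered from its set of facets.\<close>

lemma face_eq_Int_facets:
  fixes P :: "'a::euclidean_space set"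
  assumes P: "polytope P" and F: "F face_of P" "F \<noteq> {}"
  shows "F = P \<inter> \<Inter>{G. G facet_of P \<and> F \<subseteq> G}"
proof (cases "F = P")
  case True
  then show ?thesis using facet_of_imp_subset by blast
next
  case False
  then have "F = \<Inter>{G. G facet_of P \<and> F \<subseteq> G}"
    using face_of_polyhedron[OF polytope_imp_polyhedron[OF P] F(1,2)] by blast
  then show ?thesis using face_of_imp_subset[OF F(1)] by blast
qed

text \<open>A facet inside another would be a proper face of it, hence of smaller dimension, but all
  facets have the same dimension.\<close>

lemma facets_containing_facet:
  fixes P :: "'a::euclidean_space set"
  assumes G: "G facet_of P"
  shows "{H. H facet_of P \<and> G \<subseteq> H} = {G}"
proof -
  have "H = G" if H: "H facet_of P" "G \<subseteq> H" for H
  proof (rule ccontr)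
    assume "H \<noteq> G"
    have "G face_of H"
      using G H face_of_subset facet_of_imp_face_of facet_of_imp_subset by blast
    then have "aff_dim G < aff_dim H"
      using H(1) \<open>H \<noteq> G\<close> face_of_aff_dim_lt face_of_imp_convex facet_of_imp_face_of by blast
    then show False using G H(1) by (simp add: facet_of_def)
  qed
  then show ?thesis using G by auto
qed

theorem lemma12:
  fixes P :: "'a::euclidean_space set"
  assumes "polytope P"
  shows "(\<forall>k. coeff (poly (face_polynomial P) 1) k
              \<le> coeff (pcompose (poly (face_polynomial P) (-1)) [:1, 1:]) k)
       \<and> coeff (poly (face_polynomial P) 1) 0
           = coeff (pcompose (poly (face_polynomial P) (-1)) [:1, 1:]) 0
       \<and> coeff (poly (face_polynomial P) 1) 1
           = coeff (pcompose (poly (face_polynomial P) (-1)) [:1, 1:]) 1"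
proof -
  let ?X = "{G. G facet_of P}"
  define L where "L k = {F. F face_of P \<and> F \<noteq> {} \<and> num_facets_containing P F = k}" for k
  define R where "R k = {S. S \<subseteq> ?X \<and> card S = k \<and> P \<inter> \<Inter>S \<noteq> {}}" for k
  define \<phi> where "\<phi> F = {G. G facet_of P \<and> F \<subseteq> G}" for F
  have nf: "num_facets_containing P F = card (\<phi> F)" for F
    by (simp add: num_facets_containing_def \<phi>_def)
  have finX: "finite ?X" by (rule finite_polytope_facets[OF assms])
  have finR: "finite (R k)" for k
    using finX by (auto simp: R_def intro: finite_subset[of _ "Pow ?X"])
  \<comment> \<open>Thus \<open>S \<mapsto> P \<inter> \<Inter>S\<close> is a left inverse of
    \<open>\<phi>\<close>; it also shows that the intersection is nonempty, being \<open>F\<close>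
    itself.\<close>
  have rec: "F = P \<inter> \<Inter>(\<phi> F)" if "F \<in> L k" for F k
    using face_eq_Int_facets[OF assms] that by (auto simp: L_def \<phi>_def)
  have inj: "inj_on \<phi> (L k)" for k
    by (rule inj_onI) (metis rec)
  have into: "\<phi> ` L k \<subseteq> R k" for k
  proof
    fix S assume "S \<in> \<phi> ` L k"
    then obtain F where F: "F \<in> L k" "S = \<phi> F" by blast
    then have "P \<inter> \<Inter>S \<noteq> {}" using rec[OF F(1)] by (auto simp: L_def)
    then show "S \<in> R k"
      using F by (auto simp: L_def R_def \<phi>_def num_facets_containing_def)
  qed
  have "R 0 \<subseteq> \<phi> ` L 0"
  proof
    fix S assume "S \<in> R 0"
    \<comment> \<open>Infinite sets also have \<open>card\<close> 0, so finiteness of the set of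
      facets is needed to get \<open>S = {}\<close>. Its preimage is \<open>P\<close>
      itself.\<close>
    then have S: "S = {}" "P \<noteq> {}" using finite_subset[OF _ finX] by (auto simp: R_def)
    have "\<phi> P = {}"
      using facet_of_imp_subset facet_of_irrefl by (fastforce simp: \<phi>_def)
    moreover from this have "P \<in> L 0"
      using S(2) assms
      by (simp add: L_def nf face_of_refl polytope_imp_convex)
    ultimately show "S \<in> \<phi> ` L 0" using S(1) by blast
  qed
  moreover have "R 1 \<subseteq> \<phi> ` L 1"
  proof
    fix S assume "S \<in> R 1"
    then obtain G where G: "S = {G}" "G facet_of P" by (auto simp: R_def card_1_singleton_iff)
    \<comment> \<open>A singleton \<open>{G}\<close> is the image of the facet \<open>G\<close>,
      which is nonempty by the definition of \<open>facet_of\<close>.\<close>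
    have "\<phi> G = {G}" using facets_containing_facet[OF G(2)] by (simp add: \<phi>_def)
    moreover from this have "G \<in> L 1"
      using G(2) by (simp add: L_def nf facet_of_def)
    ultimately show "S \<in> \<phi> ` L 1" using G(1) by blast
  qed
  ultimately have "card (L 0) = card (R 0)" "card (L 1) = card (R 1)"
    using card_image[OF inj] into by (metis subset_antisym)+
  moreover have "card (L k) \<le> card (R k)" for k
    by (rule card_inj_on_le[OF inj into finR])
  ultimately show ?thesis
    unfolding coeff_face_polynomial_one[OF assms] coeff_pcompose_face_polynomial_minus_one[OF assms]
    by (simp add: L_def R_def)
qed

end
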